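(* Consider the micro-macro Parareal iterates $u^k_n=(x^k_n,y^k_n)$ for the linear multiscale ODE, as defined in the context. Assume that $\alpha<0$ and $\delta<0$ and that $|G|<1$. Let $e^{x,k}_{\mathrm{max}}=\max_{1\le n\le N}|x^k_n-x_n|$ and $e^{y,k}_{\mathrm{max}}=\max_{1\le n\le N}|y^k_n-y_n|$. Then, for every $k\ge 0$, $e^{x,k}_{\mathrm{max}}$ satisfies the linear bound $$e^{x,k}_{\mathrm{max}}\le\left(\frac{|F-G|}{1-|G|}\right)^k e^{x,0}_{\mathrm{max}}+\frac{|b|}{1-|G|}\sum_{i=0}^{k-1}\left(\frac{|F-G|}{1-|G|}\right)^i e^{\delta(k-1-i)\Delta t}\,e^{y,0}_{\mathrm{max}},$$ and also the superlinear bound $$e^{x,k}_{\mathrm{max}}\le|F-G|^k\binom{N-1}{k}e^{x,0}_{\mathrm{max}}+|b|\,\frac{1-|G|^{N-1}}{1-|G|}\sum_{i=0}^{k-1}|F-G|^i\binom{N-1}{i}e^{\delta(k-1-i)\Delta t}\,e^{y,0}_{\mathrm{max}}.$$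
   Context: Multiscale ODE: for $\alpha,\beta,\delta\in\mathbb R$ with $\delta<0$, $\delta\ne\alpha$ (the modelling regime is $|\delta|\gg\alpha$, with no quantitative condition imposed), consider $\frac{dx}{dt}=\alpha x+\beta y$, $\frac{dy}{dt}=\delta y$, $(x(0),y(0))=(x_0,y_0)=u_0\in\mathbb R^2$, on $[0,T]$, divided into $N\ge 1$ subintervals of length $\Delta t=T/N$. Here $x$ is the slow and $y$ the fast variable. The exact solution over one step is $u(t+\Delta t)=\mathcal A u(t)$ with $$\mathcal A=\begin{bmatrix}F&b\\0&e^{\delta\Delta t}\end{bmatrix},\qquad F=e^{\alpha\Delta t},\qquad b=(e^{\delta\Delta t}-e^{\alpha\Delta t})\frac{\beta}{\delta-\alpha}.$$ $G\in\mathbb R$ is a scalar: the one-step ($\Delta t$) propagation factor of a numerical (or exact) time-stepper for a reduced scalar ODE $dU/dt=\bar\alpha U$. Operators: fine propagator $\mathcal F(u)=\mathcal A u$ on $\mathbb R^2$; coarse propagator $\mathcal C(U)=GU$ on $\mathbb R$; restriction $\mathcal R((x,y))=x$; matching $\mathcal M(U,(x,y))=(U,y)$; lifting $\mathcal L(U)=(U,0)$. Micro-macro Parareal: $u^k_0=u_0$ and $U^k_0=\mathcal R(u_0)$ for all $k\ge0$. For $0\le n\le N-1$, in the zeroth iteration $U^0_{n+1}=\mathcal C(U^0_n)$, $u^0_{n+1}=\mathcal L(U^0_{n+1})$; and for $k\ge0$ $$U^{k+1}_{n+1}=\mathcal C(U^{k+1}_n)+\mathcal R(\mathcal F(u^k_n))-\mathcal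 C(U^k_n),\qquad u^{k+1}_{n+1}=\mathcal M(U^{k+1}_{n+1},\mathcal F(u^k_n)).$$ Write $u^k_n=(x^k_n,y^k_n)$. The reference solution is $u_n=(x_n,y_n)=\mathcal A^n u_0$. Conventions: empty sums are $0$, $0^0=1$, and $\binom{m}{j}=0$ for $j>m$. *)

theory Defs
  imports "HOL-Analysis.Analysis"
begin

text \<open>
  Arguments: fine propagator \<open>\<F>\<close> (micro states), coarse propagator \<open>\<C>\<close> (macro states),
  restriction \<open>\<R>\<close>, lifting \<open>\<L>\<close>, matching \<open>\<M>\<close>, initial micro state \<open>u0\<close>,
  iteration number \<open>k\<close>, time index \<open>n\<close>.  The recursions are stated for all \<open>n\<close>; the values
  for \<open>n \<le> N\<close> do not depend on the number \<open>N\<close> of subintervals other than through the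
  operators.
\<close>

function (sequential)
  mm_macro :: "('s \<Rightarrow> 's) \<Rightarrow> ('m \<Rightarrow> 'm) \<Rightarrow> ('s \<Rightarrow> 'm) \<Rightarrow> ('m \<Rightarrow> 's) \<Rightarrow> ('m \<Rightarrow> 's \<Rightarrow> 's) \<Rightarrow> 's \<Rightarrow>
    nat \<Rightarrow> nat \<Rightarrow> 'm::ab_group_add" and
  mm_micro :: "('s \<Rightarrow> 's) \<Rightarrow> ('m \<Rightarrow> 'm) \<Rightarrow> ('s \<Rightarrow> 'm) \<Rightarrow> ('m \<Rightarrow> 's) \<Rightarrow> ('m \<Rightarrow> 's \<Rightarrow> 's) \<Rightarrow> 's \<Rightarrow>
    nat \<Rightarrow> nat \<Rightarrow> 's"
where
  "mm_macro \<F> \<C> \<R> \<L> \<M> u0 k 0 = \<R> u0"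
| "mm_macro \<F> \<C> \<R> \<L> \<M> u0 0 (Suc n) = \<C> (mm_macro \<F> \<C> \<R> \<L> \<M> u0 0 n)"
| "mm_macro \<F> \<C> \<R> \<L> \<M> u0 (Suc k) (Suc n) =
     \<C> (mm_macro \<F> \<C> \<R> \<L> \<M> u0 (Suc k) n)
     + \<R> (\<F> (mm_micro \<F> \<C> \<R> \<L> \<M> u0 k n))
     - \<C> (mm_macro \<F> \<C> \<R> \<L> \<M> u0 k n)"
| "mm_micro \<F> \<C> \<R> \<L> \<M> u0 k 0 = u0"
| "mm_micro \<F> \<C> \<R> \<L> \<M> u0 0 (Suc n) = \<L> (mm_macro \<F> \<C> \<R> \<L> \<M> u0 0 (Suc n))"
| "mm_micro \<F> \<C> \<R> \<L> \<M> u0 (Suc k) (Suc n) =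
     \<M> (mm_macro \<F> \<C> \<R> \<L> \<M> u0 (Suc k) (Suc n)) (\<F> (mm_micro \<F> \<C> \<R> \<L> \<M> u0 k n))"
  by pat_completeness auto
termination
  by (relation "Wellfounded.measure (\<lambda>p. case p of
        Inl (_, _, _, _, _, _, k, n) \<Rightarrow> 2 * (k + n)
      | Inr (_, _, _, _, _, _, k, n) \<Rightarrow> 2 * (k + n) + 1)") auto

text \<open>
  The system \<open>x' = \<alpha> x + \<beta> y\<close>, \<open>y' = \<delta> y\<close> in \<open>real ^ 2\<close>; component 1 is the slow
  variable \<open>x\<close> and component 2 the fast variable \<open>y\<close>.
\<close>

definition ms_coeff :: "real \<Rightarrow> real \<Rightarrow> real \<Rightarrow> real ^ 2 ^ 2" where
  "ms_coeff \<alpha> \<beta> \<delta> = vector [vector [\<alpha>, \<beta>], vector [0, \<delta>]]"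

definition ms_coupling :: "real \<Rightarrow> real \<Rightarrow> real \<Rightarrow> real \<Rightarrow> real" where
  "ms_coupling \<alpha> \<beta> \<delta> h = (exp (\<delta> * h) - exp (\<alpha> * h)) * (\<beta> / (\<delta> - \<alpha>))"

definition ms_flow :: "real \<Rightarrow> real \<Rightarrow> real \<Rightarrow> real \<Rightarrow> real ^ 2 ^ 2" where
  "ms_flow \<alpha> \<beta> \<delta> h =
     vector [vector [exp (\<alpha> * h), ms_coupling \<alpha> \<beta> \<delta> h], vector [0, exp (\<delta> * h)]]"

lemma ms_flow_0: "ms_flow \<alpha> \<beta> \<delta> 0 *v u = u"
  by (simp add: ms_flow_def ms_coupling_def matrix_vector_mult_def vec_eq_iff forall_2 sum_2)

lemma ms_flow_solves_ode:
  assumes "\<delta> \<noteq> \<alpha>"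
  shows "((\<lambda>t. ms_flow \<alpha> \<beta> \<delta> t *v u) has_vector_derivative
           ms_coeff \<alpha> \<beta> \<delta> *v (ms_flow \<alpha> \<beta> \<delta> t *v u)) (at t)"
proof -
  have d: "\<delta> - \<alpha> \<noteq> 0" using assms by simp
  have 1: "((\<lambda>t. exp (\<alpha> * t) * u $ 1 + ms_coupling \<alpha> \<beta> \<delta> t * u $ 2) has_real_derivative
      \<alpha> * (exp (\<alpha> * t) * u $ 1 + ms_coupling \<alpha> \<beta> \<delta> t * u $ 2) + \<beta> * (exp (\<delta> * t) * u $ 2)) (at t)"
    unfolding ms_coupling_def
    by (rule derivative_eq_intros refl d | simp)+ (use d in \<open>simp add: field_simps\<close>)
  have 2: "((\<lambda>t. exp (\<delta> * t) * u $ 2) has_real_derivative \<delta> * (exp (\<delta> * t) * u $ 2)) (at t)"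
    by (auto intro!: derivative_eq_intros)
  show ?thesis
    unfolding has_vector_derivative_def
    apply (subst has_derivative_componentwise_within)
    using 1 2
    by (auto simp: Basis_vec_def inner_axis forall_2 ms_flow_def ms_coeff_def
        matrix_vector_mult_def sum_2 has_field_derivative_def mult.commute exhaust_2
        elim!: has_derivative_eq_rhs)
qed

definition ms_fine :: "real \<Rightarrow> real \<Rightarrow> real \<Rightarrow> real \<Rightarrow> real ^ 2 \<Rightarrow> real ^ 2" where
  "ms_fine \<alpha> \<beta> \<delta> h u = ms_flow \<alpha> \<beta> \<delta> h *v u"

definition ms_coarse :: "real \<Rightarrow> real \<Rightarrow> real" where
  "ms_coarse G U = G * U"

definition ms_restrict :: "real ^ 2 \<Rightarrow> real" where
  "ms_restrict u = u $ 1"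

definition ms_lift :: "real \<Rightarrow> real ^ 2" where
  "ms_lift U = vector [U, 0]"

definition ms_match :: "real \<Rightarrow> real ^ 2 \<Rightarrow> real ^ 2" where
  "ms_match U u = vector [U, u $ 2]"

definition ms_parareal ::
  "real \<Rightarrow> real \<Rightarrow> real \<Rightarrow> real \<Rightarrow> real \<Rightarrow> real ^ 2 \<Rightarrow> nat \<Rightarrow> nat \<Rightarrow> real ^ 2" where
  "ms_parareal \<alpha> \<beta> \<delta> h G u0 k n =
     mm_micro (ms_fine \<alpha> \<beta> \<delta> h) (ms_coarse G) ms_restrict ms_lift ms_match u0 k n"

definition ms_reference :: "real \<Rightarrow> real \<Rightarrow> real \<Rightarrow> real \<Rightarrow> real ^ 2 \<Rightarrow> nat \<Rightarrow> real ^ 2" where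
  "ms_reference \<alpha> \<beta> \<delta> h u0 n = (ms_fine \<alpha> \<beta> \<delta> h ^^ n) u0"

definition ms_max_err ::
  "2 \<Rightarrow> real \<Rightarrow> real \<Rightarrow> real \<Rightarrow> real \<Rightarrow> real \<Rightarrow> real ^ 2 \<Rightarrow> nat \<Rightarrow> nat \<Rightarrow> real" where
  "ms_max_err c \<alpha> \<beta> \<delta> h G u0 N k =
     (MAX n\<in>{1..N}. \<bar>ms_parareal \<alpha> \<beta> \<delta> h G u0 k n $ c - ms_reference \<alpha> \<beta> \<delta> h u0 n $ c\<bar>)"

end

theory Submission
  imports Defs
begin

text \<open>
  The macro state coincides with the slow component of the micro state, so the slow and fast
  errors satisfy \<open>p\<^sup>k\<^sup>+\<^sup>1(n+1) = G p\<^sup>k\<^sup>+\<^sup>1(n) + (F - G) p\<^sup>k(n) + b q\<^sup>k(n)\<close> and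
  \<open>q\<^sup>k\<^sup>+\<^sup>1(n+1) = E q\<^sup>k(n)\<close> with \<open>E = exp (\<delta> \<Delta>t)\<close>, and both vanish at \<open>n = 0\<close>.  Hence
  \<open>q\<^sup>k\<close> decays like \<open>E\<^sup>k\<close>.  Summing the geometric recursion in \<open>n\<close> bounds \<open>p\<^sup>k\<^sup>+\<^sup>1\<close> by either
  \<open>\<bar>F - G\<bar> / (1 - \<bar>G\<bar>)\<close> times the maximum of \<open>p\<^sup>k\<close>, or by \<open>\<bar>F - G\<bar>\<close> times the sum of its earlier
  values; induction on \<open>k\<close> gives the linear bound in the first case and, through the hockey-stick
  identity for binomial coefficients, the superlinear bound in the second.
\<close>

text \<open>Lifting and matching both store the macro state in the first component, and at time 0 it
  is \<open>ms_restrict u0\<close>. So the macro variable can be eliminated from the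
  recursions.\<close>

lemma mm_macro_eq_micro:
  "mm_macro (ms_fine \<alpha> \<beta> \<delta> h) (ms_coarse G) ms_restrict ms_lift ms_match u0 k n
     = ms_parareal \<alpha> \<beta> \<delta> h G u0 k n $ 1"
  unfolding ms_parareal_def
  by (cases k; cases n) (simp_all add: ms_restrict_def ms_lift_def ms_match_def)

lemma ms_fine_component:
  "ms_fine \<alpha> \<beta> \<delta> h u $ 1 = exp (\<alpha> * h) * u $ 1 + ms_coupling \<alpha> \<beta> \<delta> h * u $ 2"
  "ms_fine \<alpha> \<beta> \<delta> h u $ 2 = exp (\<delta> * h) * u $ 2"
  by (simp_all add: ms_fine_def ms_flow_def matrix_vector_mult_def sum_2)

lemma ms_parareal_0: "ms_parareal \<alpha> \<beta> \<delta> h G u0 k 0 = u0"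
  by (simp add: ms_parareal_def)

lemma ms_parareal_Suc:
  "ms_parareal \<alpha> \<beta> \<delta> h G u0 (Suc k) (Suc n) $ 1 =
     G * ms_parareal \<alpha> \<beta> \<delta> h G u0 (Suc k) n $ 1
     + (exp (\<alpha> * h) - G) * ms_parareal \<alpha> \<beta> \<delta> h G u0 k n $ 1
     + ms_coupling \<alpha> \<beta> \<delta> h * ms_parareal \<alpha> \<beta> \<delta> h G u0 k n $ 2"
  "ms_parareal \<alpha> \<beta> \<delta> h G u0 (Suc k) (Suc n) $ 2 =
     exp (\<delta> * h) * ms_parareal \<alpha> \<beta> \<delta> h G u0 k n $ 2"
proof -
  show "ms_parareal \<alpha> \<beta> \<delta> h G u0 (Suc k) (Suc n) $ 1 =
     G * ms_parareal \<alpha> \<beta> \<delta> h G u0 (Suc k) n $ 1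
     + (exp (\<alpha> * h) - G) * ms_parareal \<alpha> \<beta> \<delta> h G u0 k n $ 1
     + ms_coupling \<alpha> \<beta> \<delta> h * ms_parareal \<alpha> \<beta> \<delta> h G u0 k n $ 2"
    unfolding mm_macro_eq_micro [symmetric, of _ _ _ _ _ _ "Suc k"]
    by (simp add: mm_macro_eq_micro ms_coarse_def ms_restrict_def ms_fine_component
        ms_parareal_def [symmetric] algebra_simps)
  show "ms_parareal \<alpha> \<beta> \<delta> h G u0 (Suc k) (Suc n) $ 2 =
     exp (\<delta> * h) * ms_parareal \<alpha> \<beta> \<delta> h G u0 k n $ 2"
    by (simp add: ms_parareal_def ms_match_def ms_fine_component)
qed

lemma ms_reference_Suc:
  "ms_reference \<alpha> \<beta> \<delta> h u0 (Suc n) = ms_fine \<alpha> \<beta> \<delta> h (ms_reference \<alpha> \<beta> \<delta> h u0 n)"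
  by (simp add: ms_reference_def)

text \<open>Each step back lowers \<open>k\<close> and \<open>n\<close> together. Either
  \<open>n\<close> reaches 0 first, where \<open>c\<close> vanishes, or \<open>k\<close> factors
  \<open>E\<close> accumulate in front of a value of \<open>c 0\<close>.\<close>

lemma decay_bound:
  fixes c :: "nat \<Rightarrow> nat \<Rightarrow> real"
  assumes "0 \<le> E" and "0 \<le> Q" and "\<And>k. c k 0 = 0"
    and "\<And>k n. c (Suc k) (Suc n) \<le> E * c k n"
    and "\<And>n. 1 \<le> n \<Longrightarrow> n \<le> N \<Longrightarrow> c 0 n \<le> Q" and "n \<le> N"
  shows "c k n \<le> E ^ k * Q"
  using \<open>n \<le> N\<close>
proof (induction k arbitrary: n)
  case 0
  then show ?case using assms(2,3,5) by (cases n) auto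
next
  case (Suc k)
  show ?case
  proof (cases n)
    case 0
    then show ?thesis using assms(1-3) by simp
  next
    case (Suc m)
    then have "c (Suc k) n \<le> E * c k m" using assms(4) by simp
    also have "\<dots> \<le> E * (E ^ k * Q)"
      using Suc.IH [of m] Suc.prems Suc assms(1) by (intro mult_left_mono) auto
    finally show ?thesis by (simp add: mult_ac)
  qed
qed

text \<open>The bound is the fixed point of the map sending \<open>z\<close> to
  \<open>g * z + t\<close>, so the recursion never crosses it.\<close>

lemma geometric_recursion_max_bound:
  fixes a :: "nat \<Rightarrow> real"
  assumes "0 \<le> g" "g < 1" and "0 \<le> t" and "a 0 \<le> 0"
    and "\<And>n. n < m \<Longrightarrow> a (Suc n) \<le> g * a n + t"
  shows "a m \<le> t / (1 - g)"
  using assms(5)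
proof (induction m)
  case 0
  have "0 \<le> t / (1 - g)" using assms(2,3) by simp
  then show ?case using assms(4) by linarith
next
  case (Suc m)
  have "a (Suc m) \<le> g * a m + t" using Suc.prems by simp
  also have "\<dots> \<le> g * (t / (1 - g)) + t"
    using Suc.IH Suc.prems assms(1) by (intro add_right_mono mult_left_mono) auto
  also have "\<dots> = t / (1 - g)" using assms(2) by (simp add: field_simps)
  finally show ?case .
qed

text \<open>Unrolling weights each forcing term by a power of \<open>g\<close>. For the constant
  \<open>s\<close> the weights are summed exactly; for \<open>w\<close> they are estimated by 1,
  which leaves a plain sum.\<close>

lemma geometric_recursion_sum_bound:
  fixes a w :: "nat \<Rightarrow> real"
  assumes "0 \<le> g" "g < 1" and "a 0 \<le> 0" and "\<And>n. 0 \<le> w n"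
    and "\<And>n. n < m \<Longrightarrow> a (Suc n) \<le> g * a n + w n + s"
  shows "a m \<le> (\<Sum>j<m. w j) + s * ((1 - g ^ m) / (1 - g))"
  using assms(5)
proof (induction m)
  case 0
  then show ?case using assms(3) by simp
next
  case (Suc m)
  have W: "0 \<le> (\<Sum>j<m. w j)" using assms(4) by (intro sum_nonneg) auto
  have "a (Suc m) \<le> g * a m + w m + s" using Suc.prems by simp
  also have "\<dots> \<le> g * ((\<Sum>j<m. w j) + s * ((1 - g ^ m) / (1 - g))) + w m + s"
    using Suc.IH Suc.prems assms(1) by (intro add_right_mono mult_left_mono) auto
  also have "\<dots> = g * (\<Sum>j<m. w j) + w m + s * ((1 - g ^ Suc m) / (1 - g))"
    using assms(2) by (simp add: field_simps)
  also have "\<dots> \<le> (\<Sum>j<m. w j) + w m + s * ((1 - g ^ Suc m) / (1 - g))"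
    using mult_left_le_one_le [OF W assms(1)] assms(2) by simp
  finally show ?case by simp
qed

text \<open>For the inductive steps on \<open>k\<close>: the new fast error supplies the term
  \<open>i = 0\<close>, and one more factor in front of the old sum shifts its index.\<close>

lemma sum_power_diff_Suc:
  fixes f :: "nat \<Rightarrow> real"
  shows "(\<Sum>i<Suc k. f i * E ^ (Suc k - 1 - i)) =
    f 0 * E ^ k + (\<Sum>i<k. f (Suc i) * E ^ (k - 1 - i))"
  by (subst sum.lessThan_Suc_shift) simp

text \<open>
  In the next two lemmas \<open>a k m\<close> stands for the error at time step \<open>m + 1\<close>: the recursion starts
  one step late because the errors vanish at time \<open>0\<close>, which is why \<open>N - 1\<close> appears in the bounds.
\<close>

lemma linear_error_bound:
  fixes a :: "nat \<Rightarrow> nat \<Rightarrow> real"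
  assumes g: "0 \<le> g" "g < 1" and nn: "0 \<le> d" "0 \<le> B" "0 \<le> E" "0 \<le> P" "0 \<le> Q"
    and init: "\<And>k. a (Suc k) 0 \<le> 0"
    and step: "\<And>k n. Suc n < N \<Longrightarrow>
      a (Suc k) (Suc n) \<le> g * a (Suc k) n + d * a k n + B * (E ^ k * Q)"
    and zeroth: "\<And>n. n < N \<Longrightarrow> a 0 n \<le> P" and m: "m < N"
  shows "a k m \<le> (d / (1 - g)) ^ k * P
     + B / (1 - g) * (\<Sum>i<k. (d / (1 - g)) ^ i * E ^ (k - 1 - i) * Q)"
  using m
proof (induction k arbitrary: m)
  case 0
  then show ?case using zeroth by simp
next
  case (Suc k)
  define r where "r = d / (1 - g)"
  define W where "W = r ^ k * P + B / (1 - g) * (\<Sum>i<k. r ^ i * E ^ (k - 1 - i) * Q)"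
  have r: "0 \<le> r" using g nn by (simp add: r_def)
  have W: "0 \<le> W" unfolding W_def using g nn r
    by (intro add_nonneg_nonneg mult_nonneg_nonneg sum_nonneg) auto
  \<comment> \<open>\<open>W\<close> bounds the previous iterate uniformly in time, so the forcing
    becomes a constant.\<close>
  have "a (Suc k) m \<le> (d * W + B * (E ^ k * Q)) / (1 - g)"
  proof (rule geometric_recursion_max_bound [OF g])
    show "0 \<le> d * W + B * (E ^ k * Q)" using nn W by simp
    show "a (Suc k) (Suc n) \<le> g * a (Suc k) n + (d * W + B * (E ^ k * Q))" if "n < m" for n
    proof -
      have "d * a k n \<le> d * W"
        unfolding W_def r_def using Suc that nn by (intro mult_left_mono) auto
      then show ?thesis using step [of n k] that Suc.prems by simp
    qed
  qed (rule init)
  also have "\<dots> = r * W + B / (1 - g) * (E ^ k * Q)"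
    by (simp add: r_def add_divide_distrib)
  also have "\<dots> = r ^ Suc k * P + B / (1 - g) * (\<Sum>i<Suc k. r ^ i * E ^ (Suc k - 1 - i) * Q)"
    unfolding W_def sum_distrib_right [symmetric] sum_power_diff_Suc
    by (simp add: algebra_simps sum_distrib_left)
  finally show ?case unfolding r_def .
qed

lemma superlinear_error_bound:
  fixes a :: "nat \<Rightarrow> nat \<Rightarrow> real"
  assumes g: "0 \<le> g" "g < 1" and nn: "0 \<le> d" "0 \<le> B" "0 \<le> E" "0 \<le> Q"
    and a: "\<And>k n. 0 \<le> a k n" and init: "\<And>k. a (Suc k) 0 \<le> 0"
    and step: "\<And>k n. Suc n < N \<Longrightarrow>
      a (Suc k) (Suc n) \<le> g * a (Suc k) n + d * a k n + B * (E ^ k * Q)"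
    and zeroth: "\<And>n. n < N \<Longrightarrow> a 0 n \<le> P" and m: "m < N"
  defines "S \<equiv> (1 - g ^ (N - 1)) / (1 - g)"
  shows "a k m \<le> d ^ k * real (m choose k) * P
     + B * S * (\<Sum>i<k. d ^ i * real (m choose i) * E ^ (k - 1 - i) * Q)"
  using m
proof (induction k arbitrary: m)
  case 0
  then show ?case using zeroth by simp
next
  case (Suc k)
  \<comment> \<open>Hockey-stick identity; for \<open>m = 0\<close> both sides vanish.\<close>
  have hs: "(\<Sum>j<m. real (j choose i)) = real (m choose Suc i)" for i
    by (cases m) (simp_all add: lessThan_Suc_atMost sum_choose_upper flip: of_nat_sum)
  \<comment> \<open>Since \<open>m\<close> is at most \<open>N - 1\<close>, the factor can be made
    independent of \<open>m\<close>; then only the binomial coefficients depend on the time index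
    when the induction hypothesis is summed.\<close>
  have S: "(1 - g ^ m) / (1 - g) \<le> S"
    unfolding S_def using g Suc.prems by (intro divide_right_mono diff_left_mono power_decreasing) auto
  have "a (Suc k) m \<le> (\<Sum>j<m. d * a k j) + B * (E ^ k * Q) * ((1 - g ^ m) / (1 - g))"
    using g init a nn step Suc.prems by (intro geometric_recursion_sum_bound) auto
  also have "\<dots> \<le> (\<Sum>j<m. d * (d ^ k * real (j choose k) * P
      + B * S * (\<Sum>i<k. d ^ i * real (j choose i) * E ^ (k - 1 - i) * Q))) + B * (E ^ k * Q) * S"
    using S nn Suc by (intro add_mono sum_mono mult_left_mono) auto
  also have "(\<Sum>j<m. d * (d ^ k * real (j choose k) * P
      + B * S * (\<Sum>i<k. d ^ i * real (j choose i) * E ^ (k - 1 - i) * Q))) =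
      d ^ Suc k * P * (\<Sum>j<m. real (j choose k))
      + B * S * (\<Sum>i<k. d ^ Suc i * E ^ (k - 1 - i) * Q * (\<Sum>j<m. real (j choose i)))"
    \<comment> \<open>Exchanging the sums puts the sum over \<open>j\<close> innermost, ready for
      \<open>hs\<close>.\<close>
    unfolding distrib_left sum.distrib sum_distrib_left
    by (subst (2) sum.swap) (simp add: mult_ac)
  also have "\<dots> + B * (E ^ k * Q) * S = d ^ Suc k * real (m choose Suc k) * P
      + B * S * (\<Sum>i<Suc k. d ^ i * real (m choose i) * E ^ (Suc k - 1 - i) * Q)"
    unfolding hs sum_distrib_right [symmetric] sum_power_diff_Suc
    by (simp add: algebra_simps sum_distrib_left)
  finally show ?case .
qed

theorem lemma6:
  fixes \<alpha> \<beta> \<delta> T G :: real and u0 :: "real ^ 2" and N k :: nat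
  defines "\<Delta>t \<equiv> T / real N"
  defines "F \<equiv> exp (\<alpha> * \<Delta>t)"
  defines "b \<equiv> ms_coupling \<alpha> \<beta> \<delta> \<Delta>t"
  defines "ex \<equiv> ms_max_err 1 \<alpha> \<beta> \<delta> \<Delta>t G u0 N"
  defines "ey \<equiv> ms_max_err 2 \<alpha> \<beta> \<delta> \<Delta>t G u0 N"
  assumes "\<alpha> < 0" and "\<delta> < 0" and "\<delta> \<noteq> \<alpha>" and "T > 0" and "N \<ge> 1" and "\<bar>G\<bar> < 1"
  shows "ex k \<le> (\<bar>F - G\<bar> / (1 - \<bar>G\<bar>)) ^ k * ex 0
           + \<bar>b\<bar> / (1 - \<bar>G\<bar>)
             * (\<Sum>i<k. (\<bar>F - G\<bar> / (1 - \<bar>G\<bar>)) ^ i * exp (\<delta> * (real k - 1 - real i) * \<Delta>t) * ey 0)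
       \<and> ex k \<le> \<bar>F - G\<bar> ^ k * real ((N - 1) choose k) * ex 0
           + \<bar>b\<bar> * ((1 - \<bar>G\<bar> ^ (N - 1)) / (1 - \<bar>G\<bar>))
             * (\<Sum>i<k. \<bar>F - G\<bar> ^ i * real ((N - 1) choose i)
                        * exp (\<delta> * (real k - 1 - real i) * \<Delta>t) * ey 0)"
proof -
  define p where "p k n = \<bar>ms_parareal \<alpha> \<beta> \<delta> \<Delta>t G u0 k n $ 1 - ms_reference \<alpha> \<beta> \<delta> \<Delta>t u0 n $ 1\<bar>" for k n
  define q where "q k n = \<bar>ms_parareal \<alpha> \<beta> \<delta> \<Delta>t G u0 k n $ 2 - ms_reference \<alpha> \<beta> \<delta> \<Delta>t u0 n $ 2\<bar>" for k n
  define E where "E = exp (\<delta> * \<Delta>t)"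
  note g = abs_ge_zero [of G] \<open>\<bar>G\<bar> < 1\<close>
  have ex_eq: "ex k = (MAX n\<in>{1..N}. p k n)" for k
    by (simp add: ex_def ms_max_err_def p_def)
  have ey_eq: "ey k = (MAX n\<in>{1..N}. q k n)" for k
    by (simp add: ey_def ms_max_err_def q_def)
  have ex_ge: "p k n \<le> ex k" if "1 \<le> n" "n \<le> N" for k n
    unfolding ex_eq using that by (intro Max_ge) auto
  have ey_ge: "q k n \<le> ey k" if "1 \<le> n" "n \<le> N" for k n
    unfolding ey_eq using that by (intro Max_ge) auto
  have ex_le: "ex k \<le> X" if "\<And>m. m < N \<Longrightarrow> p k (Suc m) \<le> X" for k X
  proof -
    have "p k n \<le> X" if "n \<in> {1..N}" for n
      using that \<open>\<And>m. m < N \<Longrightarrow> p k (Suc m) \<le> X\<close> [of "n - 1"] by (cases n) auto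
    then show ?thesis unfolding ex_eq using \<open>N \<ge> 1\<close> by (subst Max_le_iff) auto
  qed
  have nn: "0 \<le> p k n" "0 \<le> q k n" for k n by (simp_all add: p_def q_def)
  have nn0: "0 \<le> ex 0" "0 \<le> ey 0"
    using ex_ge [of 1 0] ey_ge [of 1 0] nn [of 0 1] \<open>N \<ge> 1\<close> by linarith+
  have start: "p k 0 = 0" "q k 0 = 0" for k
    by (simp_all add: p_def q_def ms_parareal_0 ms_reference_def)
  have q_step: "q (Suc k) (Suc n) = E * q k n" for k n
    by (simp add: q_def E_def ms_parareal_Suc ms_reference_Suc ms_fine_component abs_mult
        flip: right_diff_distrib)
  have p_step: "p (Suc k) (Suc n) \<le> \<bar>G\<bar> * p (Suc k) n + \<bar>F - G\<bar> * p k n + \<bar>b\<bar> * q k n" for k n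
  proof -
    let ?x = "\<lambda>k n. ms_parareal \<alpha> \<beta> \<delta> \<Delta>t G u0 k n $ 1 - ms_reference \<alpha> \<beta> \<delta> \<Delta>t u0 n $ 1"
    let ?y = "\<lambda>k n. ms_parareal \<alpha> \<beta> \<delta> \<Delta>t G u0 k n $ 2 - ms_reference \<alpha> \<beta> \<delta> \<Delta>t u0 n $ 2"
    \<comment> \<open>The reference solution is a fixed point of the iteration: \<open>F\<close>
      splits as \<open>G + (F - G)\<close>. Hence the errors obey the same linear recursion as the
      iterates.\<close>
    have "?x (Suc k) (Suc n) = G * ?x (Suc k) n + (F - G) * ?x k n + b * ?y k n"
      by (simp add: ms_parareal_Suc ms_reference_Suc ms_fine_component F_def b_def algebra_simps)
    then show ?thesis
      unfolding p_def q_def abs_mult [symmetric] by linarith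
  qed
  have q_le: "q k n \<le> E ^ k * ey 0" if "n \<le> N" for k n
    by (rule decay_bound [where N = N]) (use that nn0 start q_step ey_ge in \<open>auto simp: E_def\<close>)
  \<comment> \<open>From the first iteration on, the slow component is exact after one time step,
    because both errors vanish at time 0.\<close>
  have init: "p (Suc k) (Suc 0) \<le> 0" for k
    using p_step [of k 0] by (simp add: start)
  have step: "p (Suc k) (Suc (Suc n)) \<le>
      \<bar>G\<bar> * p (Suc k) (Suc n) + \<bar>F - G\<bar> * p k (Suc n) + \<bar>b\<bar> * (E ^ k * ey 0)" if "Suc n < N" for k n
    using p_step [of k "Suc n"] mult_left_mono [OF q_le [of "Suc n" k] abs_ge_zero [of b]] that
    by simp
  have zeroth: "p 0 (Suc n) \<le> ex 0" if "n < N" for n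
    using ex_ge that by simp
  \<comment> \<open>For \<open>i < k\<close> the natural-number subtraction does not truncate, so
    the real exponent agrees with it.\<close>
  have E: "exp (\<delta> * (real k - 1 - real i) * \<Delta>t) = E ^ (k - 1 - i)" if "i < k" for i
    using that by (simp add: E_def of_nat_diff mult_ac flip: exp_of_nat_mult)
  let ?S = "(1 - \<bar>G\<bar> ^ (N - 1)) / (1 - \<bar>G\<bar>)"
  have "p k (Suc m) \<le> (\<bar>F - G\<bar> / (1 - \<bar>G\<bar>)) ^ k * ex 0 + \<bar>b\<bar> / (1 - \<bar>G\<bar>)
      * (\<Sum>i<k. (\<bar>F - G\<bar> / (1 - \<bar>G\<bar>)) ^ i * E ^ (k - 1 - i) * ey 0)" if "m < N" for m
    by (rule linear_error_bound [where a = "\<lambda>k m. p k (Suc m)" and N = N])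
      (use that g nn0 init step zeroth in \<open>auto simp: E_def\<close>)
  then have linear: "ex k \<le> (\<bar>F - G\<bar> / (1 - \<bar>G\<bar>)) ^ k * ex 0 + \<bar>b\<bar> / (1 - \<bar>G\<bar>)
      * (\<Sum>i<k. (\<bar>F - G\<bar> / (1 - \<bar>G\<bar>)) ^ i * E ^ (k - 1 - i) * ey 0)"
    by (rule ex_le)
  have S: "0 \<le> ?S" using g by (simp add: power_le_one)
  have superlinear: "ex k \<le> \<bar>F - G\<bar> ^ k * real ((N - 1) choose k) * ex 0 + \<bar>b\<bar> * ?S
      * (\<Sum>i<k. \<bar>F - G\<bar> ^ i * real ((N - 1) choose i) * E ^ (k - 1 - i) * ey 0)"
  proof (rule ex_le)
    fix m assume m: "m < N"
    have "p k (Suc m) \<le> \<bar>F - G\<bar> ^ k * real (m choose k) * ex 0 + \<bar>b\<bar> * ?S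
      * (\<Sum>i<k. \<bar>F - G\<bar> ^ i * real (m choose i) * E ^ (k - 1 - i) * ey 0)"
      by (rule superlinear_error_bound [where a = "\<lambda>k m. p k (Suc m)" and N = N])
        (use m g nn nn0 init step zeroth in \<open>auto simp: E_def\<close>)
    \<comment> \<open>The binomial coefficients increase in the upper index, so \<open>m\<close> may
      be replaced by its largest value \<open>N - 1\<close>.\<close>
    also have "\<dots> \<le> \<bar>F - G\<bar> ^ k * real ((N - 1) choose k) * ex 0 + \<bar>b\<bar> * ?S
      * (\<Sum>i<k. \<bar>F - G\<bar> ^ i * real ((N - 1) choose i) * E ^ (k - 1 - i) * ey 0)"
      using m nn0 S
      by (intro add_mono mult_left_mono mult_right_mono sum_mono of_nat_mono
          binomial_right_mono mult_nonneg_nonneg)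
        (auto simp: E_def)
    finally show "p k (Suc m) \<le> \<dots>" .
  qed
  show ?thesis using linear superlinear by (simp add: E)
qed

end
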